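(* Let $n$ be a positive integer. If $p^3$ divides $n$ for some prime $p$, then $\widehat{\mathcal{B}}_n$ contains non-trivial torsion-free groups. In particular, $\mathcal{B}_n\subsetneq\widehat{\mathcal{B}}_n$.
   Context: For elements $x,y$ of a group, $x^y=y^{-1}xy$. For a positive integer $n$, $\widehat{\mathcal{B}}_n$ denotes the class of all groups $G$ for which there exist fixed elements $x_1,\dots,x_n\in G$ such that $g^{x_1}g^{x_2}\cdots g^{x_n}=1$ for all $g\in G$. $\mathcal{B}_n$ denotes the Burnside variety of exponent $n$, i.e. the class of all groups $G$ with $g^n=1$ for all $g\in G$. *)

theory Defs
  imports "HOL-Algebra.Algebra" "HOL-Computational_Algebra.Primes"
begin

definition conjugate :: "('a, 'b) monoid_scheme \<Rightarrow> 'a \<Rightarrow> 'a \<Rightarrow> 'a" where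
  "conjugate G g x = inv\<^bsub>G\<^esub> x \<otimes>\<^bsub>G\<^esub> g \<otimes>\<^bsub>G\<^esub> x"

definition burnside_variety :: "nat \<Rightarrow> 'a monoid set" where
  "burnside_variety n = {G. group G \<and> (\<forall>g \<in> carrier G. g [^]\<^bsub>G\<^esub> n = \<one>\<^bsub>G\<^esub>)}"

(* The list xs = [x_1, ..., x_n] is chosen before g; the right fold is the ordered product
   of the conjugates of g by x_1, ..., x_n. *)
definition burnside_hat :: "nat \<Rightarrow> 'a monoid set" where
  "burnside_hat n = {G. group G \<and>
     (\<exists>xs. length xs = n \<and> set xs \<subseteq> carrier G \<and>
        (\<forall>g \<in> carrier G. foldr (\<otimes>\<^bsub>G\<^esub>) (map (conjugate G g) xs) \<one>\<^bsub>G\<^esub> = \<one>\<^bsub>G\<^esub>))}"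

definition torsion_free_group :: "('a, 'b) monoid_scheme \<Rightarrow> bool" where
  "torsion_free_group G \<longleftrightarrow> group G \<and>
     (\<forall>g \<in> carrier G. \<forall>k::nat. k > 0 \<longrightarrow> g [^]\<^bsub>G\<^esub> k = \<one>\<^bsub>G\<^esub> \<longrightarrow> g = \<one>\<^bsub>G\<^esub>)"

end

theory Submission
  imports "HOL-Number_Theory.Cong" Defs
begin

text \<open>Let \<open>A\<close> be an abelian normal subgroup of \<open>G\<close> with \<open>G/A\<close> isomorphic to \<open>(\<int>/p)\<^sup>2\<close> and acting on
  \<open>A\<close> with trivial norm. For \<open>n = p\<^sup>3\<close> choose \<open>x\<^sub>1, \<dots>, x\<^sub>n\<close> as a transversal of \<open>A\<close> with each element
  repeated \<open>p\<close> times in a row. The product of the conjugates of \<open>g\<close> is then the product over the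
  transversal of the conjugates of \<open>g\<^sup>p \<in> A\<close>, that is, the norm of \<open>g\<^sup>p\<close>, so it is trivial.
  A torsion-free such \<open>G\<close> is a fibre product over \<open>(\<int>/p)\<^sup>2\<close> of one copy of \<open>\<int>[\<zeta>\<^sub>p] \<rtimes> \<int>/p\<close> for
  each of the \<open>p + 1\<close> lines \<open>C\<close> of \<open>(\<int>/p)\<^sup>2\<close>: in the copy of \<open>C\<close>, an element lying over a nonzero
  element of \<open>C\<close> is a translation outside \<open>(1 - \<zeta>\<^sub>p)\<int>[\<zeta>\<^sub>p]\<close>, hence of infinite order.\<close>

section \<open>Products of conjugates\<close>

context group
begin

lemma foldr_mult_append:
  assumes "set xs \<subseteq> carrier G" "set ys \<subseteq> carrier G"
  shows "foldr (\<otimes>) (xs @ ys) \<one> = foldr (\<otimes>) xs \<one> \<otimes> foldr (\<otimes>) ys \<one>"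
  using assms by (induction xs) (auto simp: m_assoc)

lemma foldr_mult_replicate:
  assumes "x \<in> carrier G"
  shows "foldr (\<otimes>) (replicate k x) \<one> = x [^] k"
  using assms by (induction k) (simp_all add: nat_pow_Suc2[symmetric] del: foldr_replicate)

lemma conjugate_closed:
  assumes "g \<in> carrier G" "x \<in> carrier G"
  shows "conjugate G g x \<in> carrier G"
  using assms by (simp add: conjugate_def)

lemma conjugate_eqI:
  assumes "g \<in> carrier G" "x \<in> carrier G" "y \<in> carrier G" "x \<otimes> y = g \<otimes> x"
  shows "conjugate G g x = y"
  using assms by (metis conjugate_def inv_solve_left m_assoc m_closed inv_closed)

lemma conjugate_mult:
  assumes "g \<in> carrier G" "h \<in> carrier G" "x \<in> carrier G"
  shows "conjugate G g x \<otimes> conjugate G h x = conjugate G (g \<otimes> h) x"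
proof -
  have "x \<otimes> (conjugate G g x \<otimes> conjugate G h x) = (g \<otimes> h) \<otimes> x"
    using assms unfolding conjugate_def
    by (simp add: m_assoc) (simp add: m_assoc[symmetric])
  then show ?thesis
    using assms by (intro conjugate_eqI[symmetric]) (auto intro: conjugate_closed)
qed

lemma conjugate_nat_pow:
  assumes "g \<in> carrier G" "x \<in> carrier G"
  shows "conjugate G g x [^] k = conjugate G (g [^] (k::nat)) x"
proof (induction k)
  case 0
  show ?case using assms by (simp add: conjugate_def)
next
  case (Suc k)
  then show ?case using assms by (simp add: conjugate_mult)
qed

text \<open>A block of \<open>k\<close> equal conjugators contributes the \<open>k\<close>-th power
  of one conjugate of \<open>g\<close>, which is that conjugate of \<open>g [^] k\<close>. This
  moves the problem from \<open>g\<close> to a power lying in the abelian subgroup.\<close>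

lemma foldr_conjugate_concat_replicate:
  assumes "g \<in> carrier G" "set xs \<subseteq> carrier G"
  shows "foldr (\<otimes>) (map (conjugate G g) (concat (map (replicate k) xs))) \<one>
       = foldr (\<otimes>) (map (conjugate G (g [^] k)) xs) \<one>"
  using assms(2)
proof (induction xs)
  case (Cons x xs)
  have "foldr (\<otimes>) (map (conjugate G g) (concat (map (replicate k) (x # xs)))) \<one>
      = foldr (\<otimes>) (replicate k (conjugate G g x) @
          map (conjugate G g) (concat (map (replicate k) xs))) \<one>"
    by simp
  also have "\<dots> = conjugate G g x [^] k \<otimes>
      foldr (\<otimes>) (map (conjugate G g) (concat (map (replicate k) xs))) \<one>"
    using Cons.prems assms(1)
    by (subst foldr_mult_append, force intro: conjugate_closed, force intro: conjugate_closed)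
      (simp add: foldr_mult_replicate conjugate_closed del: foldr_replicate)
  finally show ?case
    using Cons assms(1) by (simp add: conjugate_nat_pow)
qed simp

lemma foldr_conjugate_repeat:
  assumes "g \<in> carrier G" "set xs \<subseteq> carrier G"
    and "foldr (\<otimes>) (map (conjugate G g) xs) \<one> = \<one>"
  shows "foldr (\<otimes>) (map (conjugate G g) (concat (replicate m xs))) \<one> = \<one>"
proof (induction m)
  case (Suc m)
  have "foldr (\<otimes>) (map (conjugate G g) xs @ map (conjugate G g) (concat (replicate m xs))) \<one>
    = foldr (\<otimes>) (map (conjugate G g) xs) \<one> \<otimes> foldr (\<otimes>) (map (conjugate G g) (concat (replicate m xs))) \<one>"
    using assms(1,2) by (intro foldr_mult_append) (auto intro!: conjugate_closed)
  then show ?case using Suc assms(3) by simp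
qed simp

end

lemma burnside_variety_subset_burnside_hat: "burnside_variety n \<subseteq> burnside_hat n"
proof
  fix G :: "'a monoid"
  assume "G \<in> burnside_variety n"
  then have G: "group G" "\<And>g. g \<in> carrier G \<Longrightarrow> g [^]\<^bsub>G\<^esub> n = \<one>\<^bsub>G\<^esub>"
    by (auto simp: burnside_variety_def)
  interpret group G by fact
  have "foldr (\<otimes>\<^bsub>G\<^esub>) (map (conjugate G g) (replicate n \<one>\<^bsub>G\<^esub>)) \<one>\<^bsub>G\<^esub> = \<one>\<^bsub>G\<^esub>" if "g \<in> carrier G" for g
    using that G(2) by (simp add: conjugate_def foldr_mult_replicate del: foldr_replicate)
  then show "G \<in> burnside_hat n"
    unfolding burnside_hat_def using G(1)
    by (auto intro!: exI[of _ "replicate n \<one>\<^bsub>G\<^esub>"] simp del: foldr_replicate map_replicate)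
qed

text \<open>Running through the list for \<open>k\<close> repeatedly multiplies trivial blocks;
  hence only the exponent p^3 matters.\<close>

lemma burnside_hat_dvd:
  assumes "G \<in> burnside_hat k" "k dvd n"
  shows "G \<in> burnside_hat n"
proof -
  from assms(1) obtain xs where G: "group G" and xs: "length xs = k" "set xs \<subseteq> carrier G"
    "\<And>g. g \<in> carrier G \<Longrightarrow> foldr (\<otimes>\<^bsub>G\<^esub>) (map (conjugate G g) xs) \<one>\<^bsub>G\<^esub> = \<one>\<^bsub>G\<^esub>"
    unfolding burnside_hat_def by auto
  from assms(2) obtain m where m: "n = k * m" by (elim dvdE)
  interpret group G by fact
  have "length (concat (replicate m xs)) = n"
    using xs(1) m by (simp add: length_concat sum_list_replicate)
  moreover have "set (concat (replicate m xs)) \<subseteq> carrier G"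
    using xs(2) by auto
  ultimately show ?thesis
    unfolding burnside_hat_def using G foldr_conjugate_repeat[OF _ xs(2) xs(3), of _ m] by blast
qed

section \<open>Transport along isomorphisms\<close>

lemma torsion_free_group_iso:
  assumes "torsion_free_group G" "group H" "h \<in> iso G H"
  shows "torsion_free_group H"
proof -
  interpret group_hom G H h
    using assms by (simp add: group_hom_def group_hom_axioms_def torsion_free_group_def iso_imp_homomorphism)
  have "inj_on h (carrier G)" "h ` carrier G = carrier H"
    using assms(3) by (auto simp: iso_def bij_betw_def)
  show ?thesis
    unfolding torsion_free_group_def
  proof (intro conjI ballI allI impI)
    fix y and k :: nat
    assume y: "y \<in> carrier H" "k > 0" "y [^]\<^bsub>H\<^esub> k = \<one>\<^bsub>H\<^esub>"
    then obtain x where x: "x \<in> carrier G" "y = h x"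
      using \<open>h ` carrier G = carrier H\<close> by auto
    have "h (x [^]\<^bsub>G\<^esub> k) = h \<one>\<^bsub>G\<^esub>"
      using x y by (simp add: hom_nat_pow)
    then have "x [^]\<^bsub>G\<^esub> k = \<one>\<^bsub>G\<^esub>"
      using x \<open>inj_on h (carrier G)\<close> by (simp add: inj_on_def)
    then have "x = \<one>\<^bsub>G\<^esub>"
      using assms(1) x(1) y(2) by (auto simp: torsion_free_group_def)
    then show "y = \<one>\<^bsub>H\<^esub>"
      using x(2) by simp
  qed fact
qed

lemma burnside_hat_iso:
  assumes "G \<in> burnside_hat n" "group H" "h \<in> iso G H"
  shows "H \<in> burnside_hat n"
proof -
  from assms(1) obtain xs where G: "group G" and xs: "length xs = n" "set xs \<subseteq> carrier G"
    "\<And>g. g \<in> carrier G \<Longrightarrow> foldr (\<otimes>\<^bsub>G\<^esub>) (map (conjugate G g) xs) \<one>\<^bsub>G\<^esub> = \<one>\<^bsub>G\<^esub>"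
    unfolding burnside_hat_def by auto
  interpret group_hom G H h
    using assms G by (simp add: group_hom_def group_hom_axioms_def iso_imp_homomorphism)
  have surj: "h ` carrier G = carrier H"
    using assms(3) by (auto simp: iso_def bij_betw_def)
  have hom: "h (foldr (\<otimes>\<^bsub>G\<^esub>) (map (conjugate G g) ys) \<one>\<^bsub>G\<^esub>)
      = foldr (\<otimes>\<^bsub>H\<^esub>) (map (conjugate H (h g)) (map h ys)) \<one>\<^bsub>H\<^esub>"
    if "g \<in> carrier G" "set ys \<subseteq> carrier G" for g ys
    using that(2)
  proof (induction ys)
    case (Cons y ys)
    then have "foldr (\<otimes>\<^bsub>G\<^esub>) (map (conjugate G g) ys) \<one>\<^bsub>G\<^esub> \<in> carrier G"
      using that(1) by (intro G.multlist_closed) (auto intro!: G.conjugate_closed)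
    moreover have "h (conjugate G g y) = conjugate H (h g) (h y)"
      using Cons.prems that(1) by (simp add: conjugate_def)
    ultimately show ?case
      using Cons that(1) by (simp add: G.conjugate_closed)
  qed simp
  have "foldr (\<otimes>\<^bsub>H\<^esub>) (map (conjugate H y) (map h xs)) \<one>\<^bsub>H\<^esub> = \<one>\<^bsub>H\<^esub>" if "y \<in> carrier H" for y
  proof -
    obtain x where x: "x \<in> carrier G" "y = h x"
      using surj \<open>y \<in> carrier H\<close> by auto
    then show ?thesis
      using hom[OF x(1) xs(2)] xs(3)[OF x(1)] by simp
  qed
  moreover have "length (map h xs) = n" "set (map h xs) \<subseteq> carrier H"
    using xs by auto
  ultimately show ?thesis
    unfolding burnside_hat_def using assms(2) by blast
qed

text \<open>Moves a group of functions to the carrier type \<open>nat\<close> by enumerating its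
  elements.\<close>

lemma countable_group_iso_nat:
  assumes "group G" "countable (carrier G)"
  obtains H :: "nat monoid" and h where "group H" "h \<in> iso G H"
proof -
  interpret group G by fact
  define h where "h = to_nat_on (carrier G)"
  have inj: "inj_on h (carrier G)"
    unfolding h_def using assms(2) by (rule inj_on_to_nat_on)
  have iso: "h \<in> iso G (image_group h G)"
    using inj by (auto simp: iso_def hom_def image_group_def bij_betw_def)
  have "group (image_group h G)"
    using iso_imp_img_group[OF iso] by (simp add: image_group_def)
  with iso show ?thesis by (rule that[rotated])
qed

section \<open>A torsion-free group with non-cyclic point group\<close>

lemma periodic_cong:
  fixes f :: "int \<Rightarrow> 'a"
  assumes per: "\<And>x. f (x + p) = f x" and "[x = y] (mod p)"
  shows "f x = f y"
proof -
  have nat: "f (x + int m * p) = f x" for x m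
  proof (induction m)
    case (Suc m)
    have "f (x + int (Suc m) * p) = f ((x + int m * p) + p)" by (simp add: algebra_simps)
    then show ?case using per Suc by simp
  qed simp
  obtain k where k: "y = x + k * p"
    using assms(2) by (metis cong_iff_lin mult.commute)
  show ?thesis
  proof (cases "k \<ge> 0")
    case True
    then show ?thesis using nat[of x "nat k"] k by simp
  next
    case False
    then show ?thesis using nat[of y "nat (- k)"] k by simp
  qed
qed

lemma sum_periodic_shift:
  fixes f :: "int \<Rightarrow> 'a :: comm_monoid_add"
  assumes "p > 0" and per: "\<And>x. f (x + p) = f x"
  shows "(\<Sum>x\<in>{0..<p}. f (x + k)) = (\<Sum>x\<in>{0..<p}. f x)"
  using assms(1)
  by (intro sum.reindex_bij_witness[of _ "\<lambda>x. (x - k) mod p" "\<lambda>x. (x + k) mod p"])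
     (auto simp: mod_simps intro!: periodic_cong[of f p] per simp: cong_def)

locale holonomy_prime =
  fixes p :: int
  assumes prime: "Factorial_Ring.prime p"
begin

lemma p_gt_1: "p > 1"
  using prime by (rule prime_gt_1_int)

text \<open>Adding a constant to \<open>F c\<close> changes this by a multiple of p. Its residue is
  therefore the reduction of Z[zeta_p], seen as Z^p modulo constants, to Z[zeta_p]/(1 - zeta_p) =
  Z/p.\<close>

definition period_sum :: "(int \<Rightarrow> int \<Rightarrow> int) \<Rightarrow> int \<Rightarrow> int" where
  "period_sum F c = (\<Sum>x\<in>{0..<p}. F c x)"

text \<open>With image (a, b) in the point group this is b - c*a, whose kernel is the line of slope
  c; the value c = p stands for infinite slope, a = 0. Only the residue modulo p matters, as it
  shifts p-periodic functions.\<close>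

definition twist :: "(int \<Rightarrow> int \<Rightarrow> int) \<Rightarrow> int \<Rightarrow> int" where
  "twist F c = (if c < p then period_sum F p - c * period_sum F 0 else period_sum F 0)"

text \<open>The point group \<open>(\<int>/p)\<^sup>2\<close> sees an element \<open>F\<close> through the residues of \<open>period_sum F 0\<close> and \<open>period_sum F p\<close>.
  The index \<open>c \<in> {0..p}\<close> runs through the lines of \<open>(\<int>/p)\<^sup>2\<close>, the \<open>c\<close>-th one being the kernel
  of \<open>twist _ c\<close>; the function \<open>F c\<close>, normalised by \<open>F c 0 = 0\<close>, represents an element of
  \<open>\<int>\<^sup>p\<close> modulo constants, on which the point group acts by cyclic shifts through \<open>twist _ c\<close>.\<close>

definition hol_group :: "(int \<Rightarrow> int \<Rightarrow> int) monoid" where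
  "hol_group = \<lparr>carrier = {F. (\<forall>c x. F c (x + p) = F c x) \<and> (\<forall>c. F c 0 = 0) \<and>
       (\<forall>c. c \<notin> {0..p} \<longrightarrow> F c = (\<lambda>_. 0)) \<and> (\<forall>c\<in>{0..<p}. [period_sum F c = period_sum F 0] (mod p))},
     mult = (\<lambda>F H c x. F c x + H c (x + twist F c) - H c (twist F c)),
     one = (\<lambda>_ _. 0)\<rparr>"

lemma carrierD:
  assumes "F \<in> carrier hol_group"
  shows "F c (x + p) = F c x" "F c 0 = 0" "c \<notin> {0..p} \<Longrightarrow> F c x = 0"
    "c \<in> {0..<p} \<Longrightarrow> [period_sum F c = period_sum F 0] (mod p)"
  using assms by (auto simp: hol_group_def)

lemma carrier_cong:
  assumes "F \<in> carrier hol_group" "[x = y] (mod p)"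
  shows "F c x = F c y"
  using carrierD(1)[OF assms(1)] assms(2) by (rule periodic_cong)

lemma mult_apply: "(F \<otimes>\<^bsub>hol_group\<^esub> H) c x = F c x + H c (x + twist F c) - H c (twist F c)"
  by (simp add: hol_group_def)

lemma one_apply: "\<one>\<^bsub>hol_group\<^esub> c x = 0"
  by (simp add: hol_group_def)

section \<open>Group laws and the homomorphism to the point group\<close>

lemma period_sum_shift:
  assumes "F \<in> carrier hol_group"
  shows "(\<Sum>x\<in>{0..<p}. F c (x + k)) = period_sum F c"
  unfolding period_sum_def using p_gt_1 carrierD(1)[OF assms] by (intro sum_periodic_shift) auto

lemma period_sum_mult:
  assumes "H \<in> carrier hol_group"
  shows "period_sum (F \<otimes>\<^bsub>hol_group\<^esub> H) c = period_sum F c + period_sum H c - p * H c (twist F c)"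
proof -
  have "period_sum (F \<otimes>\<^bsub>hol_group\<^esub> H) c
      = period_sum F c + (\<Sum>x\<in>{0..<p}. H c (x + twist F c)) - p * H c (twist F c)"
    using p_gt_1 by (simp add: period_sum_def mult_apply sum.distrib sum_subtractf)
  then show ?thesis using period_sum_shift[OF assms] by simp
qed

text \<open>The constant subtracted to normalise a product is counted p times in a period, so the
  residues give a homomorphism to (Z/p)^2.\<close>

lemma period_sum_mult_cong:
  assumes "H \<in> carrier hol_group"
  shows "[period_sum (F \<otimes>\<^bsub>hol_group\<^esub> H) c = period_sum F c + period_sum H c] (mod p)"
  unfolding period_sum_mult[OF assms] by (simp add: cong_iff_dvd_diff)

lemma twist_cong:
  assumes "[period_sum F 0 = period_sum H 0] (mod p)" "[period_sum F p = period_sum H p] (mod p)"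
  shows "[twist F c = twist H c] (mod p)"
  unfolding twist_def using assms by (auto intro!: cong_diff cong_mult)

lemma twist_mult_cong:
  assumes "H \<in> carrier hol_group"
  shows "[twist (F \<otimes>\<^bsub>hol_group\<^esub> H) c = twist F c + twist H c] (mod p)"
proof (cases "c < p")
  case True
  have "[period_sum (F \<otimes>\<^bsub>hol_group\<^esub> H) p - c * period_sum (F \<otimes>\<^bsub>hol_group\<^esub> H) 0
      = (period_sum F p + period_sum H p) - c * (period_sum F 0 + period_sum H 0)] (mod p)"
    using period_sum_mult_cong[OF assms] by (intro cong_diff cong_mult cong_refl)
  then show ?thesis using True by (simp add: twist_def algebra_simps)
next
  case False
  then show ?thesis using period_sum_mult_cong[OF assms] by (simp add: twist_def)
qed

lemma mult_closed:
  assumes F: "F \<in> carrier hol_group" and H: "H \<in> carrier hol_group"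
  shows "F \<otimes>\<^bsub>hol_group\<^esub> H \<in> carrier hol_group"
proof -
  let ?M = "F \<otimes>\<^bsub>hol_group\<^esub> H"
  have "?M c (x + p) = ?M c x" for c x
    using carrierD(1)[OF F, of c x] carrierD(1)[OF H, of c "x + twist F c"]
    by (simp add: mult_apply algebra_simps)
  moreover have "?M c 0 = 0" for c
    using carrierD(2)[OF F] by (simp add: mult_apply)
  moreover have "?M c = (\<lambda>_. 0)" if "c \<notin> {0..p}" for c
    using carrierD(3)[OF F that] carrierD(3)[OF H that] by (intro ext) (simp add: mult_apply)
  moreover have "[period_sum ?M c = period_sum ?M 0] (mod p)" if "c \<in> {0..<p}" for c
  proof -
    have "[period_sum F c + period_sum H c = period_sum F 0 + period_sum H 0] (mod p)"
      using carrierD(4)[OF F that] carrierD(4)[OF H that] by (rule cong_add)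
    then show ?thesis
      using period_sum_mult_cong[OF H] by (meson cong_sym cong_trans)
  qed
  ultimately show ?thesis
    by (simp add: hol_group_def)
qed

lemma period_sum_one: "period_sum (\<lambda>_ _. 0) c = 0"
  by (simp add: period_sum_def)

lemma twist_one: "twist (\<lambda>_ _. 0) c = 0"
  by (simp add: period_sum_one twist_def)

lemma period_sum_inverse:
  assumes F: "F \<in> carrier hol_group"
  shows "period_sum (\<lambda>c x. F c (- twist F c) - F c (x - twist F c)) c = p * F c (- twist F c) - period_sum F c"
  using p_gt_1 period_sum_shift[OF F, of c "- twist F c"] by (simp add: period_sum_def sum_subtractf)

lemma left_inverse:
  assumes F: "F \<in> carrier hol_group"
  defines "I \<equiv> \<lambda>c x. F c (- twist F c) - F c (x - twist F c)"
  shows "I \<in> carrier hol_group" and "I \<otimes>\<^bsub>hol_group\<^esub> F = \<one>\<^bsub>hol_group\<^esub>"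
proof -
  have tot: "period_sum I c = p * F c (- twist F c) - period_sum F c" for c
    unfolding I_def by (rule period_sum_inverse[OF F])
  have tot': "[period_sum I c = - period_sum F c] (mod p)" for c
    unfolding tot by (simp add: cong_iff_dvd_diff)
  have "I c (x + p) = I c x" for c x
    using carrierD(1)[OF F, of c "x - twist F c"] by (simp add: I_def algebra_simps)
  moreover have "I c 0 = 0" for c
    by (simp add: I_def)
  moreover have "I c = (\<lambda>_. 0)" if "c \<notin> {0..p}" for c
    using carrierD(3)[OF F that] by (intro ext) (simp add: I_def)
  moreover have "[period_sum I c = period_sum I 0] (mod p)" if "c \<in> {0..<p}" for c
    using tot' carrierD(4)[OF F that] by (meson cong_minus_minus_iff cong_sym cong_trans)
  ultimately show "I \<in> carrier hol_group"
    by (simp add: hol_group_def)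
  have tw: "[twist I c = - twist F c] (mod p)" for c
  proof (cases "c < p")
    case True
    have "[period_sum I p - c * period_sum I 0 = (- period_sum F p) - c * (- period_sum F 0)] (mod p)"
      using tot' by (intro cong_diff cong_mult cong_refl)
    then show ?thesis using True by (simp add: twist_def)
  next
    case False
    then show ?thesis using tot' by (simp add: twist_def)
  qed
  \<comment> \<open>The twist of \<open>I\<close> is only congruent to \<open>- twist F c\<close>;
    periodicity makes that enough.\<close>
  have 1: "F c (twist I c) = F c (- twist F c)" for c
    using tw by (intro carrier_cong[OF F])
  have 2: "F c (x + twist I c) = F c (x - twist F c)" for c x
    using cong_add[OF cong_refl[of x] tw[of c]] by (intro carrier_cong[OF F]) simp
  show "I \<otimes>\<^bsub>hol_group\<^esub> F = \<one>\<^bsub>hol_group\<^esub>"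
    by (intro ext) (simp add: mult_apply one_apply 1 2, simp add: I_def)
qed

lemma mult_assoc:
  assumes H: "H \<in> carrier hol_group" and K: "K \<in> carrier hol_group"
  shows "(F \<otimes>\<^bsub>hol_group\<^esub> H) \<otimes>\<^bsub>hol_group\<^esub> K = F \<otimes>\<^bsub>hol_group\<^esub> (H \<otimes>\<^bsub>hol_group\<^esub> K)"
proof (intro ext)
  fix c x
  have 1: "K c (twist (F \<otimes>\<^bsub>hol_group\<^esub> H) c) = K c (twist F c + twist H c)"
    using twist_mult_cong[OF H] by (intro carrier_cong[OF K])
  have 2: "K c (x + twist (F \<otimes>\<^bsub>hol_group\<^esub> H) c) = K c (x + (twist F c + twist H c))"
    using twist_mult_cong[OF H] by (intro carrier_cong[OF K] cong_add cong_refl)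
  show "((F \<otimes>\<^bsub>hol_group\<^esub> H) \<otimes>\<^bsub>hol_group\<^esub> K) c x = (F \<otimes>\<^bsub>hol_group\<^esub> (H \<otimes>\<^bsub>hol_group\<^esub> K)) c x"
    by (simp add: mult_apply[of _ K] 1 2) (simp add: mult_apply algebra_simps)
qed

lemma one_in_carrier: "\<one>\<^bsub>hol_group\<^esub> \<in> carrier hol_group"
  by (simp add: hol_group_def period_sum_one)

lemma one_mult: "F \<in> carrier hol_group \<Longrightarrow> \<one>\<^bsub>hol_group\<^esub> \<otimes>\<^bsub>hol_group\<^esub> F = F"
  by (simp add: hol_group_def twist_one)

sublocale H: group hol_group
  by (rule groupI) (auto intro: mult_closed one_in_carrier mult_assoc one_mult left_inverse)

section \<open>Torsion-freeness\<close>

lemma pow_apply: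
  assumes F: "F \<in> carrier hol_group" and tw: "p dvd twist F c"
  shows "p dvd twist (F [^]\<^bsub>hol_group\<^esub> k) c \<and> (F [^]\<^bsub>hol_group\<^esub> k) c x = int k * F c x"
proof (induction k)
  case 0
  show ?case by (simp add: hol_group_def twist_one)
next
  case (Suc k)
  let ?K = "F [^]\<^bsub>hol_group\<^esub> k"
  \<comment> \<open>The power acts trivially on coordinate \<open>c\<close>, so multiplying by
    \<open>F\<close> is plain addition there.\<close>
  have 1: "F c (x + twist ?K c) = F c x" "F c (twist ?K c) = F c 0"
    using Suc by (auto intro!: carrier_cong[OF F] simp: cong_iff_dvd_diff)
  have "p dvd twist (?K \<otimes>\<^bsub>hol_group\<^esub> F) c"
    using twist_mult_cong[OF F, of ?K c] Suc tw by (simp add: cong_dvd_iff)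
  moreover have "(?K \<otimes>\<^bsub>hol_group\<^esub> F) c x = int (Suc k) * F c x"
    using Suc 1 carrierD(2)[OF F] by (simp add: mult_apply algebra_simps)
  ultimately show ?case
    by simp
qed

text \<open>A torsion element vanishes in every coordinate \<open>c\<close> whose line contains its
  image (a, b). But the period sum there is a for c < p and b for c = p, modulo p, so a nonzero
  image would contradict this on the line it spans.\<close>

lemma torsion_free: "torsion_free_group hol_group"
  unfolding torsion_free_group_def
proof (intro conjI ballI allI impI)
  fix F and k :: nat
  assume F: "F \<in> carrier hol_group" and k: "k > 0" "F [^]\<^bsub>hol_group\<^esub> k = \<one>\<^bsub>hol_group\<^esub>"
  have zero: "F c x = 0" if "p dvd twist F c" for c x
    using pow_apply[OF F that, of k x] k by (simp add: one_apply)
  have period_sum_zero: "period_sum F c = 0" if "p dvd twist F c" for c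
    using zero[OF that] by (simp add: period_sum_def)
  have 0: "p dvd period_sum F 0"
  proof (rule ccontr)
    assume nd: "\<not> p dvd period_sum F 0"
    then have "coprime (period_sum F 0) p"
      using prime by (simp add: prime_imp_coprime coprime_commute)
    then obtain b where b: "[period_sum F 0 * b = 1] (mod p)"
      using cong_solve_coprime_int by blast
    \<comment> \<open>As \<open>b\<close> inverts \<open>period_sum F 0\<close>, this is the slope
      of the line through the image of \<open>F\<close>.\<close>
    define c where "c = (b * period_sum F p) mod p"
    have c: "c \<in> {0..<p}"
      using p_gt_1 by (simp add: c_def)
    have "[c * period_sum F 0 = b * period_sum F p * period_sum F 0] (mod p)"
      by (intro cong_mult cong_refl) (simp add: c_def cong_def)
    also have "b * period_sum F p * period_sum F 0 = period_sum F 0 * b * period_sum F p"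
      by simp
    also have "[period_sum F 0 * b * period_sum F p = 1 * period_sum F p] (mod p)"
      using b by (intro cong_mult cong_refl)
    finally have "[period_sum F p = c * period_sum F 0] (mod p)"
      by (simp add: cong_sym)
    then have "p dvd twist F c"
      using c by (simp add: twist_def cong_iff_dvd_diff)
    then have "period_sum F c = 0"
      by (rule period_sum_zero)
    then show False
      using cong_sym[OF carrierD(4)[OF F c]] nd by (simp add: cong_0_iff)
  qed
  \<comment> \<open>The image now lies on the line of infinite slope, so coordinate p vanishes and
    the image is trivial.\<close>
  then have "period_sum F p = 0"
    by (intro period_sum_zero) (simp add: twist_def)
  with 0 have "p dvd twist F c" for c
    by (simp add: twist_def)
  then show "F = \<one>\<^bsub>hol_group\<^esub>"
    by (intro ext) (simp add: zero one_apply)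
qed (rule H.is_group)

section \<open>Lifts of the elements of the point group\<close>

definition rep :: "int \<Rightarrow> int \<Rightarrow> int \<Rightarrow> int \<Rightarrow> int" where
  "rep i j c x = (if [x = 1] (mod p) then (if c = p then j else if c \<in> {0..<p} then i else 0) else 0)"

text \<open>A single point of each period carries the value; it is 1, since the normalisation at 0
  rules out 0. Thus \<open>rep i j\<close> lifts (i, j).\<close>

lemma period_sum_rep: "period_sum (rep i j) c = (if c = p then j else if c \<in> {0..<p} then i else 0)"
proof -
  have "[x = 1] (mod p) \<longleftrightarrow> x = 1" if "x \<in> {0..<p}" for x
    using that p_gt_1 by (auto simp: cong_def)
  then have "period_sum (rep i j) c
      = (\<Sum>x\<in>{0..<p}. if x = 1 then (if c = p then j else if c \<in> {0..<p} then i else 0) else 0)"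
    unfolding period_sum_def rep_def by (intro sum.cong) auto
  then show ?thesis
    using p_gt_1 by simp
qed

lemma twist_rep: "twist (rep i j) c = (if c < p then j - c * i else i)"
  using p_gt_1 by (simp add: twist_def period_sum_rep)

lemma rep_closed: "rep i j \<in> carrier hol_group"
proof -
  have "\<not> [0 = 1] (mod p)"
    using p_gt_1 by (simp add: cong_def)
  then have "rep i j c 0 = 0" for c
    by (simp add: rep_def)
  moreover have "rep i j c (x + p) = rep i j c x" for c x
    by (simp add: rep_def cong_def)
  moreover have "rep i j c = (\<lambda>_. 0)" if "c \<notin> {0..p}" for c
    using that p_gt_1 by (auto simp: rep_def fun_eq_iff)
  moreover have "[period_sum (rep i j) c = period_sum (rep i j) 0] (mod p)" if "c \<in> {0..<p}" for c
    using that p_gt_1 by (simp add: period_sum_rep)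
  ultimately show ?thesis
    by (simp add: hol_group_def)
qed

lemma not_trivial: "\<not> trivial_group hol_group"
proof
  assume "trivial_group hol_group"
  then have "rep 1 0 = \<one>\<^bsub>hol_group\<^esub>"
    using rep_closed by (auto simp: trivial_group_def)
  then have "period_sum (rep 1 0) 0 = period_sum \<one>\<^bsub>hol_group\<^esub> 0"
    by simp
  then show False
    using p_gt_1 by (simp add: period_sum_rep hol_group_def period_sum_one)
qed

section \<open>The translation lattice and its norm\<close>

text \<open>The translations are the elements whose image in the point group is trivial; there the
  group operation is pointwise addition.\<close>

definition translation_lattice :: "(int \<Rightarrow> int \<Rightarrow> int) set" where
  "translation_lattice = {F \<in> carrier hol_group. p dvd period_sum F 0 \<and> p dvd period_sum F p}"

lemma translation_lattice_carrier: "F \<in> translation_lattice \<Longrightarrow> F \<in> carrier hol_group"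
  by (simp add: translation_lattice_def)

lemma mult_translation:
  assumes "F \<in> translation_lattice" "H \<in> carrier hol_group"
  shows "(F \<otimes>\<^bsub>hol_group\<^esub> H) c x = F c x + H c x"
proof -
  have "p dvd twist F c"
    using assms(1) by (simp add: translation_lattice_def twist_def)
  then have "H c (x + twist F c) = H c x" "H c (twist F c) = H c 0"
    by (auto intro!: carrier_cong[OF assms(2)] simp: cong_iff_dvd_diff)
  then show ?thesis
    using carrierD(2)[OF assms(2)] by (simp add: mult_apply)
qed

text \<open>The point group has exponent p.\<close>

lemma pow_p_translation:
  assumes F: "F \<in> carrier hol_group"
  shows "F [^]\<^bsub>hol_group\<^esub> nat p \<in> translation_lattice"
proof -
  have "[period_sum (F [^]\<^bsub>hol_group\<^esub> k) c = int k * period_sum F c] (mod p)" for k :: nat and c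
  proof (induction k)
    case 0
    show ?case by (simp add: hol_group_def period_sum_one)
  next
    case (Suc k)
    have "[period_sum (F [^]\<^bsub>hol_group\<^esub> Suc k) c = period_sum (F [^]\<^bsub>hol_group\<^esub> k) c + period_sum F c] (mod p)"
      using period_sum_mult_cong[OF F] by simp
    also have "[period_sum (F [^]\<^bsub>hol_group\<^esub> k) c + period_sum F c = int k * period_sum F c + period_sum F c] (mod p)"
      using Suc by (intro cong_add cong_refl)
    finally show ?case by (simp add: algebra_simps)
  qed
  from this[of "nat p"] have "p dvd period_sum (F [^]\<^bsub>hol_group\<^esub> nat p) c" for c
    using p_gt_1 by (subst cong_dvd_iff) auto
  then show ?thesis
    using F by (simp add: translation_lattice_def)
qed

text \<open>Translations add pointwise, so the translation part of \<open>T\<close> cancels and only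
  its shift acts on \<open>A\<close>. Checking \<open>T\<close> times \<open>?Y\<close> against
  \<open>A\<close> times \<open>T\<close> avoids computing an inverse.\<close>

lemma conjugate_translation:
  assumes A: "A \<in> translation_lattice" and T: "T \<in> carrier hol_group"
  shows "conjugate hol_group A T = (\<lambda>c x. A c (x - twist T c) - A c (- twist T c))" (is "_ = ?Y")
    and "conjugate hol_group A T \<in> translation_lattice"
proof -
  note Ac = translation_lattice_carrier[OF A]
  have tot: "period_sum ?Y c = period_sum A c - p * A c (- twist T c)" for c
    using p_gt_1 period_sum_shift[OF Ac, of c "- twist T c"] by (simp add: period_sum_def sum_subtractf)
  have tot': "[period_sum ?Y c = period_sum A c] (mod p)" for c
    unfolding tot by (simp add: cong_iff_dvd_diff)
  have "?Y c (x + p) = ?Y c x" for c x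
    using carrierD(1)[OF Ac, of c "x - twist T c"] by (simp add: algebra_simps)
  moreover have "[period_sum ?Y c = period_sum ?Y 0] (mod p)" if "c \<in> {0..<p}" for c
    using tot' carrierD(4)[OF Ac that] by (meson cong_sym cong_trans)
  ultimately have Y: "?Y \<in> carrier hol_group"
    using carrierD(3)[OF Ac] by (auto simp: hol_group_def)
  have "T \<otimes>\<^bsub>hol_group\<^esub> ?Y = A \<otimes>\<^bsub>hol_group\<^esub> T"
    using carrierD(2)[OF Ac] by (intro ext) (simp add: mult_translation[OF A T], simp add: mult_apply)
  then show "conjugate hol_group A T = ?Y"
    using Ac T Y by (intro H.conjugate_eqI)
  moreover have "?Y \<in> translation_lattice"
    using Y A cong_dvd_iff[OF tot'] by (simp add: translation_lattice_def)
  ultimately show "conjugate hol_group A T \<in> translation_lattice"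
    by simp
qed

lemma foldr_translation_lattice:
  assumes "set fs \<subseteq> translation_lattice"
  shows "foldr (\<otimes>\<^bsub>hol_group\<^esub>) fs \<one>\<^bsub>hol_group\<^esub> c x = (\<Sum>F\<leftarrow>fs. F c x)"
  using assms
proof (induction fs)
  case (Cons F fs)
  then have "foldr (\<otimes>\<^bsub>hol_group\<^esub>) fs \<one>\<^bsub>hol_group\<^esub> \<in> carrier hol_group"
    by (intro H.multlist_closed) (auto dest: translation_lattice_carrier)
  then show ?case
    using Cons by (simp add: mult_translation)
qed (simp add: one_apply)

definition reps :: "(int \<Rightarrow> int \<Rightarrow> int) list" where
  "reps = map (\<lambda>(i, j). rep i j) (List.product [0..p - 1] [0..p - 1])"

lemma sum_list_reps: "(\<Sum>T\<leftarrow>reps. f T) = (\<Sum>i\<in>{0..<p}. \<Sum>j\<in>{0..<p}. f (rep i j))"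
proof -
  have "(\<Sum>T\<leftarrow>reps. f T) = (\<Sum>(i, j)\<leftarrow>List.product [0..p - 1] [0..p - 1]. f (rep i j))"
    by (simp add: reps_def o_def case_prod_unfold)
  also have "\<dots> = (\<Sum>(i, j)\<in>{0..p - 1} \<times> {0..p - 1}. f (rep i j))"
    by (subst sum.distinct_set_conv_list[symmetric]) (auto simp: distinct_product)
  also have "{0..p - 1} = {0..<p}"
    by auto
  finally show ?thesis
    by (simp add: sum.cartesian_product)
qed

text \<open>On each coordinate \<open>c\<close> the norm of the point group is \<open>p\<close> times the norm of a
  cyclic group permuting the coordinates of \<open>\<int>\<^sup>p\<close> modulo constants.\<close>

lemma sum_conjugates_translation:
  assumes A: "A \<in> translation_lattice"
  shows "(\<Sum>T\<leftarrow>reps. conjugate hol_group A T c x) = 0"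
proof -
  note Ac = translation_lattice_carrier[OF A]
  \<comment> \<open>A period traversed backwards from any start has the same sum, so the two sums
    below cancel.\<close>
  have neg: "(\<Sum>j\<in>{0..<p}. A c (k - j)) = period_sum A c" for k
  proof -
    have "(\<Sum>j\<in>{0..<p}. A c (k - j)) = (\<Sum>j\<in>{0..<p}. A c (j + (k - p + 1)))"
      by (rule sum.reindex_bij_witness[of _ "\<lambda>j. p - 1 - j" "\<lambda>j. p - 1 - j"]) auto
    then show ?thesis by (simp add: period_sum_shift[OF Ac])
  qed
  have "(\<Sum>T\<leftarrow>reps. conjugate hol_group A T c x)
      = (\<Sum>i\<in>{0..<p}. \<Sum>j\<in>{0..<p}. A c (x - twist (rep i j) c) - A c (- twist (rep i j) c))"
    by (simp add: sum_list_reps conjugate_translation(1)[OF A rep_closed])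
  also have "\<dots> = 0"
  proof (cases "c < p")
    case True
    \<comment> \<open>For fixed \<open>i\<close> the twist \<open>j - c * i\<close> already meets
      every residue once. In the other case the twist is \<open>i\<close>, and \<open>j\<close>
      merely gives a factor p.\<close>
    have "(\<Sum>j\<in>{0..<p}. A c (x - twist (rep i j) c) - A c (- twist (rep i j) c)) = 0" for i
      using neg[of "x + c * i"] neg[of "c * i"] True
      by (simp add: twist_rep sum_subtractf algebra_simps)
    then show ?thesis by simp
  next
    case False
    then show ?thesis
      using neg[of x] neg[of 0]
      by (simp add: twist_rep sum_distrib_left[symmetric] sum_subtractf)
  qed
  finally show ?thesis .
qed

lemma hol_group_in_burnside_hat: "hol_group \<in> burnside_hat (nat p ^ 3)"
proof -
  define xs where "xs = concat (map (replicate (nat p)) reps)"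
  have "length xs = nat p ^ 3"
    by (simp add: xs_def length_concat o_def reps_def sum_list_triv power3_eq_cube)
  moreover have reps: "set reps \<subseteq> carrier hol_group"
    by (auto simp: reps_def rep_closed)
  then have "set xs \<subseteq> carrier hol_group"
    by (auto simp: xs_def)
  moreover have "foldr (\<otimes>\<^bsub>hol_group\<^esub>) (map (conjugate hol_group F) xs) \<one>\<^bsub>hol_group\<^esub> = \<one>\<^bsub>hol_group\<^esub>"
    if F: "F \<in> carrier hol_group" for F
  proof -
    let ?A = "F [^]\<^bsub>hol_group\<^esub> nat p"
    have A: "?A \<in> translation_lattice"
      by (rule pow_p_translation[OF F])
    have "foldr (\<otimes>\<^bsub>hol_group\<^esub>) (map (conjugate hol_group F) xs) \<one>\<^bsub>hol_group\<^esub>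
        = foldr (\<otimes>\<^bsub>hol_group\<^esub>) (map (conjugate hol_group ?A) reps) \<one>\<^bsub>hol_group\<^esub>"
      unfolding xs_def by (rule H.foldr_conjugate_concat_replicate[OF F reps])
    also have "\<dots> = \<one>\<^bsub>hol_group\<^esub>"
    proof (intro ext)
      fix c x
      have "set (map (conjugate hol_group ?A) reps) \<subseteq> translation_lattice"
        using reps conjugate_translation(2)[OF A] by auto
      then show "foldr (\<otimes>\<^bsub>hol_group\<^esub>) (map (conjugate hol_group ?A) reps) \<one>\<^bsub>hol_group\<^esub> c x
          = \<one>\<^bsub>hol_group\<^esub> c x"
        by (simp add: foldr_translation_lattice sum_conjugates_translation[OF A] one_apply o_def)
    qed
    finally show ?thesis .
  qed
  ultimately show ?thesis
    unfolding burnside_hat_def using H.is_group by blast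
qed

text \<open>By periodicity an element is determined by a (p + 1) by p table of integers.\<close>

lemma countable_hol_group: "countable (carrier hol_group)"
proof (rule countableI')
  show "inj_on (\<lambda>F. map (\<lambda>c. map (F c) [0..p - 1]) [0..p]) (carrier hol_group)"
  proof (rule inj_onI, intro ext)
    fix F H c x
    assume F: "F \<in> carrier hol_group" and H: "H \<in> carrier hol_group"
      and eq: "map (\<lambda>c. map (F c) [0..p - 1]) [0..p] = map (\<lambda>c. map (H c) [0..p - 1]) [0..p]"
    show "F c x = H c x"
    proof (cases "c \<in> {0..p}")
      case True
      have "F c (x mod p) = H c (x mod p)"
        using eq True p_gt_1 by simp
      then show ?thesis
        using carrier_cong[OF F, of x "x mod p" c] carrier_cong[OF H, of x "x mod p" c]
        by (simp add: cong_def)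
    next
      case False
      then show ?thesis
        using carrierD(3)[OF F] carrierD(3)[OF H] by simp
    qed
  qed
qed

end

theorem theorem4p2:
  fixes n :: nat
  assumes "n > 0"
    and "\<exists>p::nat. Factorial_Ring.prime p \<and> p ^ 3 dvd n"
  shows "(\<exists>G :: nat monoid. G \<in> burnside_hat n \<and> torsion_free_group G \<and> \<not> trivial_group G) \<and>
         (burnside_variety n :: 'a monoid set) \<subseteq> burnside_hat n \<and>
         (burnside_variety n :: nat monoid set) \<subset> burnside_hat n"
proof -
  from assms(2) obtain p :: nat where p: "Factorial_Ring.prime p" "p ^ 3 dvd n"
    by blast
  interpret holonomy_prime "int p"
    using p(1) by unfold_locales simp
  obtain G :: "nat monoid" and h where G: "group G" "h \<in> iso hol_group G"
    using countable_group_iso_nat[OF H.is_group countable_hol_group] by blast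
  have hat: "G \<in> burnside_hat n"
    using burnside_hat_iso[OF hol_group_in_burnside_hat G] p(2) by (simp add: burnside_hat_dvd)
  have tf: "torsion_free_group G"
    using torsion_free_group_iso[OF torsion_free G] .
  have nt: "\<not> trivial_group G"
    using not_trivial G H.is_group isomorphic_group_triviality is_isoI by blast
  \<comment> \<open>Exponent \<open>n > 0\<close> would make every element torsion, hence
    trivial.\<close>
  have "G \<notin> burnside_variety n"
    using tf nt assms(1) group.is_monoid[OF G(1), THEN monoid.one_closed]
    by (auto simp: burnside_variety_def torsion_free_group_def trivial_group_def)
  with hat have "(burnside_variety n :: nat monoid set) \<subset> burnside_hat n"
    using burnside_variety_subset_burnside_hat[of n] by blast
  with hat tf nt show ?thesis
    using burnside_variety_subset_burnside_hat by blast
qed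

end
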